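(* Let $b\in\mathbb{C}$, let $\varphi\equiv b$ be the constant function on $\mathbb{C}$, and let $\psi$ be a non-zero entire function such that $C_{\psi,\varphi}$ is bounded on the Fock space $\mathcal{F}^2$ (equivalently, $\psi\in\mathcal{F}^2$). Then: (a) If $K_{b}=\frac{c}{\|\psi\|^{2}}\psi$ for some non-zero complex number $c$, then $W(C_{\psi,\varphi})$ is the closed line segment from $0$ to $\overline{c}$. (b) If $K_{b}\perp\psi$, then $W(C_{\psi,\varphi})$ is the closed disk centered at the origin with radius $\frac{\|\psi\|}{2}e^{\frac{|b|^{2}}{2}}$. (c) Otherwise, $W(C_{\psi,\varphi})$ is a closed ellipse with foci at $0$ and $\psi(b)$. In particular, in all cases $0\in W(C_{\psi,\varphi})$.
   Context: The Fock space $\mathcal{F}^2$ is the Hilbert space of all entire functions $f:\mathbb{C}\to\mathbb{C}$ that are square integrable with respect to $d\mu(z)=\pi^{-1}e^{-|z|^2}\,dA(z)$, where $dA$ is Lebesgue measure on $\mathbb{C}$, with inner product $\langle f,g\rangle=\int_{\mathbb{C}}f\overline{g}\,d\mu$ and norm $\|\cdot\|$. The reproducing kernel at $w\in\mathbb{C}$ is $K_w(z)=e^{\overline{w}z}$, so $\langle f,K_w\rangle=f(w)$ and $\|K_w\|=e^{|w|^2/2}$. For entire functions $\psi,\varphi$, the weighted composition operator is $C_{\psi,\varphi}h=\psi\cdot(h\circ\varphi)$; for $\varphi\equiv b$ this is $C_{\psi,\varphi}f=f(b)\psi$. The numerical range of a bounded operator $T$ on a Hilbert space is $W(T)=\{\langle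 Tf,f\rangle:\|f\|=1\}$. "Closed ellipse" means the closed elliptical disk (the curve together with its interior). *)

theory Defs
  imports "HOL-Complex_Analysis.Complex_Analysis"
begin

definition fock_measure :: "complex measure" where
  "fock_measure = density lborel (\<lambda>z. ennreal (exp (- (cmod z)\<^sup>2) / pi))"

definition fock_space :: "(complex \<Rightarrow> complex) set" where
  "fock_space = {f. f holomorphic_on UNIV \<and> integrable fock_measure (\<lambda>z. (cmod (f z))\<^sup>2)}"

definition fock_inner :: "(complex \<Rightarrow> complex) \<Rightarrow> (complex \<Rightarrow> complex) \<Rightarrow> complex" where
  "fock_inner f g = (LINT z|fock_measure. f z * cnj (g z))"

definition fock_norm :: "(complex \<Rightarrow> complex) \<Rightarrow> real" where
  "fock_norm f = sqrt (LINT z|fock_measure. (cmod (f z))\<^sup>2)"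

definition fock_kernel :: "complex \<Rightarrow> complex \<Rightarrow> complex" where
  "fock_kernel w = (\<lambda>z. exp (cnj w * z))"

definition weighted_comp ::
    "(complex \<Rightarrow> complex) \<Rightarrow> (complex \<Rightarrow> complex) \<Rightarrow> (complex \<Rightarrow> complex) \<Rightarrow> complex \<Rightarrow> complex" where
  "weighted_comp \<psi> \<phi> h = (\<lambda>z. \<psi> z * h (\<phi> z))"

text \<open>Linearity is not required here: it is automatic for weighted composition operators.\<close>

definition fock_bounded :: "((complex \<Rightarrow> complex) \<Rightarrow> complex \<Rightarrow> complex) \<Rightarrow> bool" where
  "fock_bounded T \<longleftrightarrow>
     (\<forall>f\<in>fock_space. T f \<in> fock_space) \<and>
     (\<exists>M. \<forall>f\<in>fock_space. fock_norm (T f) \<le> M * fock_norm f)"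

definition numerical_range ::
    "((complex \<Rightarrow> complex) \<Rightarrow> complex \<Rightarrow> complex) \<Rightarrow> complex set" where
  "numerical_range T = {fock_inner (T f) f | f. f \<in> fock_space \<and> fock_norm f = 1}"

text \<open>The elliptical disk with foci \<open>p\<close> and \<open>q\<close>. The strict inequality excludes the empty set
  and degenerate ellipses (line segments, and single points if \<open>p = q\<close>).\<close>

definition closed_ellipse_with_foci :: "complex \<Rightarrow> complex \<Rightarrow> complex set \<Rightarrow> bool" where
  "closed_ellipse_with_foci p q S \<longleftrightarrow> (\<exists>r > dist p q. S = {z. dist z p + dist z q \<le> r})"

end

(* With K = K_b the operator is the rank one map f |-> <f, K> psi, and in all three cases
   its numerical range is the set {w. |w| + |w - psi(b)| <= |psi| |K|}.

   For a unit vector f put w = <f, K> <psi, f>, and let P be the projection onto the complement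
   of f. Then w - <psi, K> = - <P psi, P K>, so Cauchy-Schwarz in the Fock space and in R^2 gives
   |w| + |w - psi(b)| <= |psi| |K|. For the converse take f in the span of K and a unit vector
   orthogonal to K.

   The reproducing property <f, K_w> = f(w) follows, after translating by w, from the mean value
   property of entire functions, because the Gaussian measure is invariant under rotations. *)

theory Submission
  imports Defs "HOL-Probability.Distributions"
begin

subsection \<open>Rotation invariance of Lebesgue measure on the complex plane\<close>

text \<open>Lebesgue measure is determined by its values on open boxes, and the preimage of such a
  box is a product of two open intervals. This makes Tonelli's theorem available for integrals over
  the complex plane.\<close>

lemma lborel_complex_eq:
  "(lborel :: complex measure) = distr (lborel \<Otimes>\<^sub>M lborel) borel (\<lambda>(x, y). Complex x y)"
proof (rule lborel_eqI)
  fix l u :: complex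
  assume "\<And>b. b \<in> Basis \<Longrightarrow> l \<bullet> b \<le> u \<bullet> b"
  from this[of 1] this[of \<i>] have le: "Re l \<le> Re u" "Im l \<le> Im u"
    by (simp_all add: Basis_complex_def)
  have [measurable]: "(\<lambda>(x, y). Complex x y) \<in> borel_measurable (lborel \<Otimes>\<^sub>M lborel)"
    unfolding lborel_prod measurable_lborel2 Complex_eq
    by (intro borel_measurable_continuous_onI) (auto simp: case_prod_beta intro!: continuous_intros)
  have pre: "(\<lambda>(x, y). Complex x y) -` box l u = {Re l<..<Re u} \<times> {Im l<..<Im u}"
    by (auto simp: box_def Basis_complex_def)
  show "emeasure (distr (lborel \<Otimes>\<^sub>M lborel) borel (\<lambda>(x, y). Complex x y)) (box l u) =
    ennreal (\<Prod>b\<in>Basis. (u - l) \<bullet> b)"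
    using le by (simp add: emeasure_distr pre space_pair_measure lborel.emeasure_pair_measure_Times
        Basis_complex_def ennreal_mult)
qed simp

text \<open>Both orders are used: each shear below translates one coordinate by a multiple of the
  other, and the translated coordinate has to be the inner variable.\<close>

lemma nn_integral_lborel_complex:
  fixes f :: "complex \<Rightarrow> ennreal"
  assumes [measurable]: "f \<in> borel_measurable borel"
  shows "(\<integral>\<^sup>+ z. f z \<partial>lborel) = (\<integral>\<^sup>+ x. \<integral>\<^sup>+ y. f (Complex x y) \<partial>lborel \<partial>lborel)"
    and "(\<integral>\<^sup>+ z. f z \<partial>lborel) = (\<integral>\<^sup>+ y. \<integral>\<^sup>+ x. f (Complex x y) \<partial>lborel \<partial>lborel)"
proof -
  have [measurable]: "(\<lambda>(x, y). Complex x y) \<in> borel_measurable (lborel \<Otimes>\<^sub>M lborel)"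
    unfolding lborel_prod measurable_lborel2 Complex_eq
    by (intro borel_measurable_continuous_onI) (auto simp: case_prod_beta intro!: continuous_intros)
  have eq: "(\<integral>\<^sup>+ z. f z \<partial>lborel) = (\<integral>\<^sup>+ (x, y). f (Complex x y) \<partial>(lborel \<Otimes>\<^sub>M lborel))"
    by (subst lborel_complex_eq) (simp add: nn_integral_distr case_prod_beta')
  have meas: "(\<lambda>(x, y). f (Complex x y)) \<in> borel_measurable (lborel \<Otimes>\<^sub>M lborel)"
    using measurable_compose[OF \<open>(\<lambda>(x, y). Complex x y) \<in> _\<close> assms]
    by (simp add: case_prod_beta')
  show "(\<integral>\<^sup>+ z. f z \<partial>lborel) = (\<integral>\<^sup>+ x. \<integral>\<^sup>+ y. f (Complex x y) \<partial>lborel \<partial>lborel)"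
    unfolding eq using lborel.nn_integral_fst[OF meas] by simp
  show "(\<integral>\<^sup>+ z. f z \<partial>lborel) = (\<integral>\<^sup>+ y. \<integral>\<^sup>+ x. f (Complex x y) \<partial>lborel \<partial>lborel)"
    unfolding eq using lborel_pair.nn_integral_snd[OF meas] by simp
qed

text \<open>For fixed imaginary part the shear is a translation of the real line, so the inner
  integral over \<open>x\<close> does not change.\<close>

lemma lborel_complex_shear_Re: "distr lborel lborel (\<lambda>z. Complex (Re z + c * Im z) (Im z)) = lborel"
proof (rule measure_eqI)
  fix A :: "complex set"
  assume "A \<in> sets (distr lborel lborel (\<lambda>z. Complex (Re z + c * Im z) (Im z)))"
  then have [measurable]: "A \<in> sets borel" by simp
  have [measurable]: "(\<lambda>z. Complex (Re z + c * Im z) (Im z)) \<in> borel_measurable borel"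
    unfolding Complex_eq by (intro borel_measurable_continuous_onI continuous_intros)
  have sec: "(\<lambda>x. indicator A (Complex x y) :: ennreal) \<in> borel_measurable borel" for y
    unfolding Complex_eq by measurable
  have shift: "(\<integral>\<^sup>+ x. indicator A (Complex (x + t) y) \<partial>lborel) = (\<integral>\<^sup>+ x. indicator A (Complex x y) \<partial>lborel :: ennreal)" for y t
    using nn_integral_real_affine[where c = 1 and t = t, OF sec[of y]] by (simp add: add.commute)
  have "emeasure (distr lborel lborel (\<lambda>z. Complex (Re z + c * Im z) (Im z))) A
      = (\<integral>\<^sup>+ z. indicator A (Complex (Re z + c * Im z) (Im z)) \<partial>lborel)"
    using nn_integral_distr[of "(\<lambda>z. Complex (Re z + c * Im z) (Im z))" lborel lborel "indicator A"] by simp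
  also have "\<dots> = (\<integral>\<^sup>+ y. \<integral>\<^sup>+ x. indicator A (Complex (x + c * y) y) \<partial>lborel \<partial>lborel)"
    by (subst nn_integral_lborel_complex(2)) simp_all
  also have "\<dots> = (\<integral>\<^sup>+ y. \<integral>\<^sup>+ x. indicator A (Complex x y) \<partial>lborel \<partial>lborel)"
    by (simp add: shift)
  also have "\<dots> = emeasure lborel A"
    by (subst nn_integral_lborel_complex(2)[symmetric]) simp_all
  finally show "emeasure (distr lborel lborel (\<lambda>z. Complex (Re z + c * Im z) (Im z))) A
    = emeasure lborel A" .
qed simp

lemma lborel_complex_shear_Im: "distr lborel lborel (\<lambda>z. Complex (Re z) (Im z + c * Re z)) = lborel"
proof (rule measure_eqI)
  fix A :: "complex set"
  assume "A \<in> sets (distr lborel lborel (\<lambda>z. Complex (Re z) (Im z + c * Re z)))"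
  then have [measurable]: "A \<in> sets borel" by simp
  have [measurable]: "(\<lambda>z. Complex (Re z) (Im z + c * Re z)) \<in> borel_measurable borel"
    unfolding Complex_eq by (intro borel_measurable_continuous_onI continuous_intros)
  have sec: "(\<lambda>y. indicator A (Complex x y) :: ennreal) \<in> borel_measurable borel" for x
    unfolding Complex_eq by measurable
  have shift: "(\<integral>\<^sup>+ y. indicator A (Complex x (y + t)) \<partial>lborel) = (\<integral>\<^sup>+ y. indicator A (Complex x y) \<partial>lborel :: ennreal)" for x t
    using nn_integral_real_affine[where c = 1 and t = t, OF sec[of x]] by (simp add: add.commute)
  have "emeasure (distr lborel lborel (\<lambda>z. Complex (Re z) (Im z + c * Re z))) A
      = (\<integral>\<^sup>+ z. indicator A (Complex (Re z) (Im z + c * Re z)) \<partial>lborel)"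
    using nn_integral_distr[of "(\<lambda>z. Complex (Re z) (Im z + c * Re z))" lborel lborel "indicator A"] by simp
  also have "\<dots> = (\<integral>\<^sup>+ x. \<integral>\<^sup>+ y. indicator A (Complex x (y + c * x)) \<partial>lborel \<partial>lborel)"
    by (subst nn_integral_lborel_complex(1)) simp_all
  also have "\<dots> = (\<integral>\<^sup>+ x. \<integral>\<^sup>+ y. indicator A (Complex x y) \<partial>lborel \<partial>lborel)"
    by (simp add: shift)
  also have "\<dots> = emeasure lborel A"
    by (subst nn_integral_lborel_complex(1)[symmetric]) simp_all
  finally show "emeasure (distr lborel lborel (\<lambda>z. Complex (Re z) (Im z + c * Re z))) A
    = emeasure lborel A" .
qed simp

lemma distr_lborel_comp:
  fixes f g :: "complex \<Rightarrow> complex"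
  assumes "distr lborel lborel f = lborel" "distr lborel lborel g = lborel"
    and "f \<in> borel_measurable borel" "g \<in> borel_measurable borel"
  shows "distr lborel lborel (\<lambda>z. f (g z)) = lborel"
  using distr_distr[of f lborel lborel g lborel] assms by (simp add: comp_def)

text \<open>A rotation by an angle that is not a multiple of \<open>\<pi>\<close> is a product of three shears.\<close>

lemma lborel_complex_rotation:
  assumes "cmod u = 1"
  shows "distr lborel lborel (\<lambda>z. u * z) = lborel"
proof -
  have *: "distr lborel lborel (\<lambda>z. u * z) = lborel" if "cmod u = 1" "Im u \<noteq> 0" for u
  proof -
    \<comment> \<open>For \<open>u = cis \<theta>\<close> this is
      \<open>- tan (\<theta> / 2)\<close>. The rotation is the horizontal shear by \<open>c\<close>,
      then the vertical shear by \<open>sin \<theta>\<close>, then the horizontal shear by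
      \<open>c\<close> again.\<close>
    define c where "c = (Re u - 1) / Im u"
    define S where "S = (\<lambda>z. Complex (Re z + c * Im z) (Im z))"
    define S' where "S' = (\<lambda>z. Complex (Re z) (Im z + Im u * Re z))"
    have meas: "S \<in> borel_measurable borel" "S' \<in> borel_measurable borel"
      "(\<lambda>z. S' (S z)) \<in> borel_measurable borel"
      unfolding S_def S'_def Complex_eq by (intro borel_measurable_continuous_onI continuous_intros)+
    have [simp]: "distr lborel lborel S = lborel" "distr lborel lborel S' = lborel"
      unfolding S_def S'_def by (rule lborel_complex_shear_Re lborel_complex_shear_Im)+
    have u: "Re u * Re u + Im u * Im u = 1"
      using that by (simp add: cmod_def power2_eq_square)
    have c: "c * Im u = Re u - 1"
      using that by (simp add: c_def)
    have c2: "c * (1 + Re u) = - Im u"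
      using that u by (simp add: c_def field_simps)
    have SSS: "S (S' (S z)) = u * z" for z
    proof (rule complex_eqI)
      have "Re (S (S' (S z))) = Re z + c * Im u * Re z + (c + c * (1 + c * Im u)) * Im z"
        by (simp add: S_def S'_def algebra_simps)
      also have "\<dots> = Re (u * z)"
        unfolding c using c2 by (simp add: algebra_simps)
      finally show "Re (S (S' (S z))) = Re (u * z)" .
      have "Im (S (S' (S z))) = Im u * Re z + (1 + c * Im u) * Im z"
        by (simp add: S_def S'_def algebra_simps)
      then show "Im (S (S' (S z))) = Im (u * z)"
        unfolding c by (simp add: algebra_simps)
    qed
    have "distr lborel lborel (\<lambda>z. S (S' (S z))) = lborel"
      using meas distr_lborel_comp[of S "\<lambda>z. S' (S z)"] distr_lborel_comp[of S' S] by simp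
    then show ?thesis unfolding SSS .
  qed
  show ?thesis
  proof (cases "Im u = 0")
    case False
    then show ?thesis using * assms by blast
  next
    case True
    \<comment> \<open>For real \<open>u\<close> the quotient \<open>c\<close> has denominator
      \<open>0\<close>; instead \<open>u\<close> is the product of \<open>- \<i>\<close> and
      \<open>\<i> * u\<close>, neither of which is real.\<close>
    then have "Im (\<i> * u) \<noteq> 0"
      using assms by (auto simp: cmod_def)
    then have "distr lborel lborel (\<lambda>z. - \<i> * (\<i> * u * z)) = lborel"
      using assms by (intro distr_lborel_comp[of "\<lambda>z. - \<i> * z" "\<lambda>z. \<i> * u * z"] * )
        (simp_all add: norm_mult)
    moreover have "(\<lambda>z. - \<i> * (\<i> * u * z)) = (\<lambda>z. u * z)"
      by (simp add: fun_eq_iff mult.assoc[symmetric])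
    ultimately show ?thesis by simp
  qed
qed

subsection \<open>The Gaussian measure\<close>

lemma sets_fock_measure [simp, measurable_cong]: "sets fock_measure = sets borel"
  and space_fock_measure [simp]: "space fock_measure = UNIV"
  by (simp_all add: fock_measure_def)

text \<open>The density factors into two copies of the normal density with mean \<open>0\<close> and
  variance \<open>1/2\<close>, one for each coordinate.\<close>

lemma prob_space_fock_measure: "prob_space fock_measure"
proof
  let ?g = "\<lambda>x::real. exp (- x\<^sup>2) / sqrt pi"
  have g: "(\<integral>\<^sup>+ x. ennreal (?g x) \<partial>lborel) = 1"
  proof -
    have eq: "?g x = normal_density 0 (1 / sqrt 2) x" for x
      by (simp add: normal_density_def power_divide)
    have "prob_space (density lborel (\<lambda>x. ennreal (?g x)))"
      unfolding eq by (rule prob_space_normal_density) simp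
    from prob_space.emeasure_space_1[OF this]
    have "emeasure (density lborel (\<lambda>x. ennreal (?g x))) UNIV = 1"
      by simp
    then show ?thesis by (simp add: emeasure_density)
  qed
  have "emeasure fock_measure UNIV = (\<integral>\<^sup>+ z. ennreal (exp (- (cmod z)\<^sup>2) / pi) \<partial>lborel)"
    by (simp add: fock_measure_def emeasure_density)
  also have "\<dots> = (\<integral>\<^sup>+ z. ennreal (\<Prod>b\<in>(Basis::complex set). ?g (z \<bullet> b)) \<partial>lborel)"
  proof (intro nn_integral_cong arg_cong[where f = ennreal])
    fix z :: complex
    have "exp (- (cmod z)\<^sup>2) = exp (- (Re z)\<^sup>2) * exp (- (Im z)\<^sup>2)"
      by (simp add: cmod_power2 exp_add[symmetric])
    then show "exp (- (cmod z)\<^sup>2) / pi = (\<Prod>b\<in>Basis. ?g (z \<bullet> b))"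
      by (simp add: Basis_complex_def)
  qed
  also have "\<dots> = (\<integral>\<^sup>+ z. (\<Prod>b\<in>(Basis::complex set). ennreal (?g (z \<bullet> b))) \<partial>lborel)"
    by (simp add: prod_ennreal)
  also have "\<dots> = (\<Prod>b\<in>(Basis::complex set). (\<integral>\<^sup>+ x. ennreal (?g x) \<partial>lborel))"
    by (rule nn_integral_lborel_prod) auto
  finally show "emeasure fock_measure (space fock_measure) = 1"
    unfolding g by simp
qed

text \<open>The density depends only on \<open>cmod z\<close>, so the invariance of Lebesgue measure
  carries over.\<close>

lemma fock_measure_rotation:
  assumes "cmod u = 1"
  shows "distr fock_measure fock_measure (\<lambda>z. u * z) = fock_measure"
proof (rule measure_eqI)
  fix A assume "A \<in> sets (distr fock_measure fock_measure (\<lambda>z. u * z))"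
  then have [measurable]: "A \<in> sets borel" by simp
  let ?w = "\<lambda>z::complex. ennreal (exp (- (cmod z)\<^sup>2) / pi)"
  have "emeasure (distr fock_measure fock_measure (\<lambda>z. u * z)) A
      = (\<integral>\<^sup>+ z. indicator A (u * z) \<partial>fock_measure)"
    using nn_integral_distr[of "\<lambda>z. u * z" fock_measure fock_measure "indicator A"] by simp
  also have "\<dots> = (\<integral>\<^sup>+ z. ?w z * indicator A (u * z) \<partial>lborel)"
    unfolding fock_measure_def by (rule nn_integral_density) measurable
  also have "\<dots> = (\<integral>\<^sup>+ z. ?w (u * z) * indicator A (u * z) \<partial>lborel)"
    using assms by (simp add: norm_mult)
  also have "\<dots> = (\<integral>\<^sup>+ z. ?w z * indicator A z \<partial>distr lborel lborel (\<lambda>z. u * z))"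
    by (rule nn_integral_distr[symmetric]) measurable
  also have "\<dots> = emeasure fock_measure A"
    unfolding lborel_complex_rotation[OF assms] by (simp add: fock_measure_def emeasure_density)
  finally show "emeasure (distr fock_measure fock_measure (\<lambda>z. u * z)) A = emeasure fock_measure A" .
qed simp

section \<open>Mean value property and translation of the Gaussian integral\<close>

lemma holomorphic_circle_mean:
  assumes "h holomorphic_on UNIV"
  shows "(LINT t|restrict_space lborel {0..2*pi}. h (cis t * z)) = complex_of_real (2 * pi) * h 0"
proof -
  have "(\<lambda>\<zeta>. \<zeta> * z) holomorphic_on UNIV"
    by (intro holomorphic_intros)
  from holomorphic_on_compose_gen[OF this assms]
  have "(\<lambda>\<zeta>. h (\<zeta> * z)) holomorphic_on UNIV"
    by (simp add: comp_def)
  \<comment> \<open>Cauchy's integral formula at \<open>0\<close> for \<open>h (\<zeta> * z)\<close>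
    as a function of \<zeta> on the unit circle. After parametrisation the factor
    \<open>cis t\<close> of the derivative cancels the denominator.\<close>
  then have "((\<lambda>\<zeta>. h (\<zeta> * z) / (\<zeta> - 0)) has_contour_integral (2 * of_real pi * \<i> * h (0 * z)))
      (circlepath 0 1)"
    by (intro Cauchy_integral_circlepath_simple) (auto intro: holomorphic_on_subset)
  then have "((\<lambda>t. h (cis t * z) / cis t * \<i> * cis t) has_integral (2 * of_real pi * \<i> * h 0)) {0..2*pi}"
    unfolding circlepath_def by (subst (asm) has_contour_integral_part_circlepath_iff) simp_all
  then have "((\<lambda>t. (1/\<i>) * (h (cis t * z) / cis t * \<i> * cis t)) has_integral (1/\<i>) * (2 * of_real pi * \<i> * h 0)) {0..2*pi}"
    by (rule has_integral_mult_right)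
  then have hi: "((\<lambda>t. h (cis t * z)) has_integral (2 * of_real pi * h 0)) {0..2*pi}"
    by (simp add: field_simps)
  have "continuous_on UNIV h"
    using assms by (rule holomorphic_on_imp_continuous_on)
  then have "continuous_on {0..2*pi} (\<lambda>t. h (cis t * z))"
    by (rule continuous_on_compose2) (auto intro!: continuous_intros)
  then have "set_integrable lborel {0..2*pi} (\<lambda>t. h (cis t * z))"
    by (intro borel_integrable_atLeastAtMost')
  then have "(LINT t:{0..2*pi}|lborel. h (cis t * z)) = integral {0..2*pi} (\<lambda>t. h (cis t * z))"
    by (rule set_borel_integral_eq_integral)
  also have "\<dots> = 2 * of_real pi * h 0"
    using hi by (rule integral_unique)
  finally show ?thesis
    by (simp add: integral_restrict_space set_lebesgue_integral_def)
qed

text \<open>The function \<open>g (cis t * z)\<close> is integrated over \<open>t\<close> and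
  \<open>z\<close> in both orders. Integrating over \<open>t\<close> first gives
  \<open>2 * pi * g 0\<close> for every \<open>z\<close>; integrating over \<open>z\<close> first
  gives the integral of \<open>g\<close> for every \<open>t\<close>, by rotation invariance.\<close>

lemma fock_measure_mean_value:
  assumes hol: "g holomorphic_on UNIV" and int: "integrable fock_measure g"
  shows "(LINT z|fock_measure. g z) = g 0"
proof -
  let ?N = "restrict_space lborel {0..2*pi} :: real measure"
  interpret P: prob_space fock_measure by (rule prob_space_fock_measure)
  interpret N: finite_measure ?N
    by (rule finite_measureI) (simp add: emeasure_restrict_space)
  interpret NP: pair_sigma_finite ?N fock_measure by unfold_locales
  have "continuous_on UNIV g"
    using hol by (rule holomorphic_on_imp_continuous_on)
  then have [measurable]: "g \<in> borel_measurable borel"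
    by (rule borel_measurable_continuous_onI)
  have [measurable]: "cis \<in> borel_measurable borel"
    by (intro borel_measurable_continuous_onI continuous_intros)
  have [measurable]: "cis \<in> borel_measurable ?N"
    by (rule measurable_restrict_space1) simp
  have rot: "(LINT z|fock_measure. f (cis t * z)) = (LINT z|fock_measure. f z)"
    if "f \<in> borel_measurable borel" for t and f :: "complex \<Rightarrow> 'b::{banach, second_countable_topology}"
    using integral_distr[of "\<lambda>z. cis t * z" fock_measure fock_measure f] that
    by (simp add: fock_measure_rotation)
  have rot_int: "integrable fock_measure (\<lambda>z. g (cis t * z))" for t
    using int integrable_distr_eq[of "\<lambda>z. cis t * z" fock_measure fock_measure g]
    by (simp add: fock_measure_rotation)
  \<comment> \<open>By rotation invariance the integral of \<open>norm (g (cis t * z))\<close> over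
    \<open>z\<close> is the same for all \<open>t\<close>, and a constant is integrable over the
    bounded interval.\<close>
  have "integrable (?N \<Otimes>\<^sub>M fock_measure) (\<lambda>(t, z). g (cis t * z))"
  proof (rule NP.Fubini_integrable)
    show "integrable ?N (\<lambda>t. LINT z|fock_measure. norm (case (t, z) of (t, z) \<Rightarrow> g (cis t * z)))"
      using rot[of "\<lambda>z. norm (g z)"] by simp
  qed (simp_all add: rot_int)
  then have "(LINT z|fock_measure. LINT t|?N. g (cis t * z)) = (LINT t|?N. LINT z|fock_measure. g (cis t * z))"
    by (rule NP.Fubini_integral)
  then have "complex_of_real (2 * pi) * g 0 = complex_of_real (2 * pi) * (LINT z|fock_measure. g z)"
    by (simp add: holomorphic_circle_mean[OF hol] rot P.prob_space[simplified] measure_restrict_space scaleR_conv_of_real)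
  then show ?thesis by simp
qed

text \<open>Expanding |w + z|^2 shows that the exponential factor is the quotient of the Gaussian
  densities at \<open>w + z\<close> and at \<open>z\<close>; the rest is translation invariance of
  Lebesgue measure.\<close>

lemma fock_integral_shift:
  fixes h :: "complex \<Rightarrow> 'b::{banach, second_countable_topology}"
  assumes [measurable]: "h \<in> borel_measurable borel"
  shows "integrable fock_measure h \<longleftrightarrow>
      integrable fock_measure (\<lambda>z. exp (- (2 * Re (cnj w * z)) - (cmod w)\<^sup>2) *\<^sub>R h (w + z))" (is ?int)
    and "(LINT z|fock_measure. h z) =
      (LINT z|fock_measure. exp (- (2 * Re (cnj w * z)) - (cmod w)\<^sup>2) *\<^sub>R h (w + z))" (is ?eq)
proof -
  let ?w = "\<lambda>z::complex. exp (- (cmod z)\<^sup>2) / pi"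
  have weight: "?w z *\<^sub>R (exp (- (2 * Re (cnj w * z)) - (cmod w)\<^sup>2) *\<^sub>R h (w + z)) = ?w (w + z) *\<^sub>R h (w + z)" for z
  proof -
    have "- (cmod z)\<^sup>2 + (- (2 * Re (cnj w * z)) - (cmod w)\<^sup>2) = - (cmod (w + z))\<^sup>2"
      by (simp add: cmod_power2) (simp add: power2_eq_square algebra_simps)
    then have "exp (- (cmod z)\<^sup>2) * exp (- (2 * Re (cnj w * z)) - (cmod w)\<^sup>2) = exp (- (cmod (w + z))\<^sup>2)"
      by (metis exp_add)
    then show ?thesis by simp
  qed
  show ?int
  proof -
    have dens: "integrable fock_measure f \<longleftrightarrow> integrable lborel (\<lambda>z. ?w z *\<^sub>R f z)"
      if "f \<in> borel_measurable borel" for f :: "complex \<Rightarrow> 'b"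
      unfolding fock_measure_def by (rule integrable_density) (use that in auto)
    have "integrable fock_measure h \<longleftrightarrow> integrable (distr lborel borel ((+) w)) (\<lambda>z. ?w z *\<^sub>R h z)"
      unfolding lborel_distr_plus by (rule dens) fact
    also have "\<dots> \<longleftrightarrow> integrable lborel (\<lambda>z. ?w (w + z) *\<^sub>R h (w + z))"
      by (rule integrable_distr_eq) measurable
    finally show ?thesis
      by (subst dens) (simp_all only: weight, measurable)
  qed
  show ?eq
  proof -
    have dens: "(LINT z|fock_measure. f z) = (LINT z|lborel. ?w z *\<^sub>R f z)"
      if "f \<in> borel_measurable borel" for f :: "complex \<Rightarrow> 'b"
      unfolding fock_measure_def by (rule integral_density) (use that in auto)
    have "(LINT z|fock_measure. h z) = (LINT z|distr lborel borel ((+) w). ?w z *\<^sub>R h z)"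
      unfolding lborel_distr_plus by (rule dens) fact
    also have "\<dots> = (LINT z|lborel. ?w (w + z) *\<^sub>R h (w + z))"
      by (rule integral_distr) measurable
    finally show ?thesis
      by (subst dens) (simp_all only: weight, measurable)
  qed
qed

subsection \<open>The Fock space\<close>

lemma fock_space_measurable:
  assumes "f \<in> fock_space"
  shows "f \<in> borel_measurable borel"
  using assms
  by (auto simp: fock_space_def intro!: borel_measurable_continuous_onI holomorphic_on_imp_continuous_on)

lemma borel_measurable_cnj [measurable]: "cnj \<in> borel_measurable borel"
  by (intro borel_measurable_continuous_onI continuous_intros)

lemma fock_space_integrable_mult:
  assumes "f \<in> fock_space" "g \<in> fock_space"
  shows "integrable fock_measure (\<lambda>z. f z * cnj (g z))"
proof (rule Bochner_Integration.integrable_bound)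
  show "integrable fock_measure (\<lambda>z. (cmod (f z))\<^sup>2 + (cmod (g z))\<^sup>2)"
    using assms by (auto simp: fock_space_def)
  note [measurable] = fock_space_measurable[OF assms(1)] fock_space_measurable[OF assms(2)]
  show "(\<lambda>z. f z * cnj (g z)) \<in> borel_measurable fock_measure"
    by measurable
  have "x * y \<le> x\<^sup>2 + y\<^sup>2" for x y :: real
    using sum_squares_bound[of x y] zero_le_power2[of x] zero_le_power2[of y] by linarith
  then show "AE z in fock_measure. norm (f z * cnj (g z)) \<le> norm ((cmod (f z))\<^sup>2 + (cmod (g z))\<^sup>2)"
    by (simp add: norm_mult)
qed

text \<open>The combination \<open>f + a * g\<close> is the common form of multiples, projections
  and expansions in two vectors, so closure and the rules for inner products are stated for it.
  Integrability rests on |u + v|^2 <= 2|u|^2 + 2|v|^2.\<close>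

lemma fock_space_add_scale:
  assumes "f \<in> fock_space" "g \<in> fock_space"
  shows "(\<lambda>z. f z + a * g z) \<in> fock_space"
proof -
  note [measurable] = fock_space_measurable[OF assms(1)] fock_space_measurable[OF assms(2)]
  have "integrable fock_measure (\<lambda>z. (cmod (f z + a * g z))\<^sup>2)"
  proof (rule Bochner_Integration.integrable_bound)
    show "integrable fock_measure (\<lambda>z. 2 * (cmod (f z))\<^sup>2 + 2 * ((cmod a)\<^sup>2 * (cmod (g z))\<^sup>2))"
      using assms by (auto simp: fock_space_def)
    show "(\<lambda>z. (cmod (f z + a * g z))\<^sup>2) \<in> borel_measurable fock_measure"
      by measurable
    have "(cmod (u + v))\<^sup>2 \<le> 2 * (cmod u)\<^sup>2 + 2 * (cmod v)\<^sup>2" for u v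
      using power_mono[OF norm_triangle_ineq[of u v], of 2] sum_squares_bound[of "cmod u" "cmod v"]
      by (simp add: power2_sum)
    from this[of "f z" "a * g z" for z]
    show "AE z in fock_measure. norm ((cmod (f z + a * g z))\<^sup>2)
        \<le> norm (2 * (cmod (f z))\<^sup>2 + 2 * ((cmod a)\<^sup>2 * (cmod (g z))\<^sup>2))"
      by (simp add: norm_mult power_mult_distrib)
  qed
  then show ?thesis
    using assms by (auto simp: fock_space_def intro!: holomorphic_intros)
qed

lemma fock_space_zero: "(\<lambda>_. 0) \<in> fock_space"
  by (simp add: fock_space_def)

lemma fock_space_scale: "g \<in> fock_space \<Longrightarrow> (\<lambda>z. a * g z) \<in> fock_space"
  using fock_space_add_scale[OF fock_space_zero] by simp

section \<open>Sesquilinearity, projections and the Cauchy-Schwarz inequality\<close>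

lemma fock_inner_add_scale:
  assumes "f \<in> fock_space" "g \<in> fock_space" "h \<in> fock_space"
  shows "fock_inner (\<lambda>z. f z + a * g z) h = fock_inner f h + a * fock_inner g h"
  using fock_space_integrable_mult[OF assms(1,3)] fock_space_integrable_mult[OF assms(2,3)]
  by (simp add: fock_inner_def distrib_right mult.assoc)

lemma fock_inner_scale: "fock_inner (\<lambda>z. a * g z) h = a * fock_inner g h"
  by (simp add: fock_inner_def mult.assoc)

lemma fock_inner_cnj: "cnj (fock_inner f g) = fock_inner g f"
  unfolding fock_inner_def Bochner_Integration.integral_cnj[symmetric] by (simp add: mult.commute)

lemma fock_inner_add_scale_right:
  assumes "f \<in> fock_space" "g \<in> fock_space" "h \<in> fock_space"
  shows "fock_inner h (\<lambda>z. f z + a * g z) = fock_inner h f + cnj a * fock_inner h g"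
  using arg_cong[OF fock_inner_add_scale[OF assms], of cnj] by (simp add: fock_inner_cnj)

lemma fock_inner_scale_right: "fock_inner h (\<lambda>z. a * g z) = cnj a * fock_inner h g"
  using arg_cong[OF fock_inner_scale[of a g h], of cnj] by (simp add: fock_inner_cnj)

lemma fock_norm_nonneg [simp]: "0 \<le> fock_norm f"
  by (simp add: fock_norm_def)

lemma fock_inner_self: "fock_inner f f = complex_of_real ((fock_norm f)\<^sup>2)"
proof -
  have "fock_inner f f = (LINT z|fock_measure. complex_of_real ((cmod (f z))\<^sup>2))"
    unfolding fock_inner_def complex_norm_square ..
  also have "\<dots> = complex_of_real ((fock_norm f)\<^sup>2)"
    by (simp add: fock_norm_def del: of_real_power)
  finally show ?thesis .
qed

lemma fock_norm_add_scale:
  assumes "f \<in> fock_space" "g \<in> fock_space"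
  shows "(fock_norm (\<lambda>z. f z + a * g z))\<^sup>2
    = (fock_norm f)\<^sup>2 + 2 * Re (cnj a * fock_inner f g) + (cmod a)\<^sup>2 * (fock_norm g)\<^sup>2"
proof -
  have "complex_of_real ((fock_norm (\<lambda>z. f z + a * g z))\<^sup>2)
      = fock_inner f f + (cnj a * fock_inner f g + cnj (cnj a * fock_inner f g)) + a * cnj a * fock_inner g g"
    unfolding fock_inner_self[symmetric] using assms
    by (simp add: fock_inner_add_scale fock_inner_add_scale_right fock_space_add_scale fock_inner_cnj
        algebra_simps)
  also have "\<dots> = complex_of_real ((fock_norm f)\<^sup>2 + 2 * Re (cnj a * fock_inner f g)
      + (cmod a)\<^sup>2 * (fock_norm g)\<^sup>2)"
    unfolding fock_inner_self complex_add_cnj complex_norm_square[symmetric] by simp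
  finally show ?thesis
    by (simp only: of_real_eq_iff)
qed

lemma fock_norm_scale: "fock_norm (\<lambda>z. a * f z) = cmod a * fock_norm f"
  by (simp add: fock_norm_def norm_mult power_mult_distrib real_sqrt_mult)

text \<open>Pythagoras for the component of \<open>f\<close> orthogonal to \<open>g\<close>. That
  the left side is nonnegative yields Cauchy-Schwarz; its vanishing later settles the case of
  equality.\<close>

lemma fock_norm_sub_projection:
  assumes "f \<in> fock_space" "g \<in> fock_space" "fock_norm g \<noteq> 0"
  shows "(fock_norm (\<lambda>z. f z + - (fock_inner f g / of_real ((fock_norm g)\<^sup>2)) * g z))\<^sup>2
    = (fock_norm f)\<^sup>2 - (cmod (fock_inner f g))\<^sup>2 / (fock_norm g)\<^sup>2"
proof -
  let ?u = "fock_inner f g" and ?n = "(fock_norm g)\<^sup>2"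
  have re: "Re (cnj (- (?u / of_real ?n)) * ?u) = - ((cmod ?u)\<^sup>2 / ?n)"
  proof -
    have "cnj (- (?u / of_real ?n)) * ?u = complex_of_real (- ((cmod ?u)\<^sup>2 / ?n))"
      using complex_norm_square[of ?u] by (simp add: mult.commute)
    then show ?thesis by (simp only: Re_complex_of_real)
  qed
  have nm: "(cmod (- (?u / of_real ?n)))\<^sup>2 * ?n = (cmod ?u)\<^sup>2 / ?n"
    using assms(3) unfolding norm_minus_cancel norm_divide norm_of_real
    by (simp add: power_divide power2_eq_square)
  show ?thesis
    unfolding fock_norm_add_scale[OF assms(1,2)] re nm by simp
qed

lemma fock_Cauchy_Schwarz:
  assumes "f \<in> fock_space" "g \<in> fock_space"
  shows "cmod (fock_inner f g) \<le> fock_norm f * fock_norm g"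
proof (cases "fock_norm g = 0")
  case False
  have "0 \<le> (fock_norm f)\<^sup>2 - (cmod (fock_inner f g))\<^sup>2 / (fock_norm g)\<^sup>2"
    unfolding fock_norm_sub_projection[OF assms False, symmetric] by simp
  then have "(cmod (fock_inner f g))\<^sup>2 \<le> (fock_norm f * fock_norm g)\<^sup>2"
    using False by (simp add: field_simps power_mult_distrib)
  then show ?thesis by (rule power2_le_imp_le) simp
next
  case True
  let ?u = "fock_inner f g"
  \<comment> \<open>Definiteness of the norm is only derived later, from this inequality. With
    \<open>fock_norm g = 0\<close> the squared norm of \<open>f - t * ?u * g\<close> is affine in
    \<open>t\<close>, and it can stay nonnegative for all \<open>t\<close> only if \<open>?u\<close>
    vanishes.\<close>
  have "0 \<le> (fock_norm f)\<^sup>2 - 2 * t * (cmod ?u)\<^sup>2" for t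
  proof -
    have "Re (cnj (- of_real t * ?u) * ?u) = - t * (cmod ?u)\<^sup>2"
      using cmod_power2[of ?u] by (simp add: power2_eq_square algebra_simps)
    then show ?thesis
      using fock_norm_add_scale[OF assms, of "- of_real t * ?u"] True
        zero_le_power2[of "fock_norm (\<lambda>z. f z + - of_real t * ?u * g z)"]
      by simp
  qed
  \<comment> \<open>If \<open>?u\<close> were nonzero, this \<open>t\<close> would make the right
    side equal to \<open>-1\<close>.\<close>
  from this[of "((fock_norm f)\<^sup>2 + 1) / (2 * (cmod ?u)\<^sup>2)"] have "?u = 0"
    by (cases "?u = 0") (auto simp: field_simps)
  then show ?thesis by simp
qed

section \<open>Kernel functions and the reproducing property\<close>

lemma fock_kernel_in_fock_space: "fock_kernel w \<in> fock_space"
proof -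
  interpret prob_space fock_measure by (rule prob_space_fock_measure)
  \<comment> \<open>Translation by \<open>w\<close> turns the integrand into a constant, which is
    integrable over a probability measure.\<close>
  have "exp (- (2 * Re (cnj w * z)) - (cmod w)\<^sup>2) *\<^sub>R (cmod (fock_kernel w (w + z)))\<^sup>2
      = exp ((cmod w)\<^sup>2)" for z
  proof -
    have "- (2 * Re (cnj w * z)) - (cmod w)\<^sup>2 + 2 * Re (cnj w * (w + z)) = (cmod w)\<^sup>2"
      by (simp add: cmod_power2) (simp add: power2_eq_square algebra_simps)
    then have "exp (- (2 * Re (cnj w * z)) - (cmod w)\<^sup>2) * exp (2 * Re (cnj w * (w + z))) = exp ((cmod w)\<^sup>2)"
      by (metis exp_add)
    then show ?thesis
      unfolding fock_kernel_def norm_exp_eq_Re exp_double[symmetric] by simp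
  qed
  moreover have "(\<lambda>z. (cmod (fock_kernel w z))\<^sup>2) \<in> borel_measurable borel"
    unfolding fock_kernel_def by (intro borel_measurable_continuous_onI continuous_intros)
  ultimately have "integrable fock_measure (\<lambda>z. (cmod (fock_kernel w z))\<^sup>2)"
    by (subst fock_integral_shift(1)[where w = w]) simp_all
  then show ?thesis
    by (auto simp: fock_space_def fock_kernel_def intro!: holomorphic_intros)
qed

lemma fock_reproducing:
  assumes "f \<in> fock_space"
  shows "fock_inner f (fock_kernel w) = f w"
proof -
  have hol: "f holomorphic_on UNIV"
    using assms by (simp add: fock_space_def)
  have "(\<lambda>z. w + z) holomorphic_on UNIV"
    by (intro holomorphic_intros)
  from holomorphic_on_compose_gen[OF this hol]
  have hol': "(\<lambda>z. exp (- cnj w * z) * f (w + z)) holomorphic_on UNIV"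
    by (auto simp: comp_def intro!: holomorphic_intros)
  have meas: "(\<lambda>z. f z * cnj (fock_kernel w z)) \<in> borel_measurable borel"
    using borel_measurable_integrable[OF fock_space_integrable_mult[OF assms fock_kernel_in_fock_space]]
    by simp
  \<comment> \<open>In the sum of the exponents of the translation weight and of the conjugated
    kernel the terms in \<open>cnj z\<close> cancel. What remains is entire and has the value
    \<open>f w\<close> at \<open>0\<close>.\<close>
  have eq: "exp (- (2 * Re (cnj w * z)) - (cmod w)\<^sup>2) *\<^sub>R (f (w + z) * cnj (fock_kernel w (w + z)))
      = exp (- cnj w * z) * f (w + z)" for z
  proof -
    have "complex_of_real (- (2 * Re (cnj w * z)) - (cmod w)\<^sup>2) + cnj (cnj w * (w + z)) = - cnj w * z"
      by (simp add: complex_eq_iff cmod_power2) (simp add: power2_eq_square algebra_simps)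
    then have "exp (complex_of_real (- (2 * Re (cnj w * z)) - (cmod w)\<^sup>2)) * exp (cnj (cnj w * (w + z)))
        = exp (- cnj w * z)"
      by (metis exp_add)
    then show ?thesis
      unfolding scaleR_conv_of_real fock_kernel_def exp_cnj exp_of_real
      by (metis mult.assoc mult.commute)
  qed
  have "integrable fock_measure (\<lambda>z. exp (- cnj w * z) * f (w + z))"
    using fock_space_integrable_mult[OF assms fock_kernel_in_fock_space[of w]]
    unfolding fock_integral_shift(1)[OF meas, of w] eq .
  from fock_measure_mean_value[OF hol' this] show ?thesis
    unfolding fock_inner_def fock_integral_shift(2)[OF meas, of w] eq by simp
qed

text \<open>The reproducing property applied to the kernel itself gives the squared norm as its
  value at \<open>w\<close>.\<close>

lemma fock_norm_kernel: "fock_norm (fock_kernel w) = exp ((cmod w)\<^sup>2 / 2)"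
proof -
  have "complex_of_real ((fock_norm (fock_kernel w))\<^sup>2) = complex_of_real (exp ((cmod w)\<^sup>2))"
    unfolding fock_inner_self[symmetric] fock_reproducing[OF fock_kernel_in_fock_space]
    unfolding fock_kernel_def exp_of_real[symmetric] complex_norm_square by (simp add: mult.commute)
  then have "(fock_norm (fock_kernel w))\<^sup>2 = (exp ((cmod w)\<^sup>2 / 2))\<^sup>2"
    unfolding of_real_eq_iff by (simp add: exp_double[symmetric])
  then show ?thesis by (simp add: power2_eq_iff_nonneg)
qed

text \<open>Each value \<open>f w\<close> is an inner product with a kernel, so Cauchy-Schwarz makes
  it vanish at every point and not merely almost everywhere.\<close>

lemma fock_norm_eq_0D:
  assumes "f \<in> fock_space" "fock_norm f = 0"
  shows "f = (\<lambda>_. 0)"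
proof
  fix w
  show "f w = 0"
    using fock_Cauchy_Schwarz[OF assms(1) fock_kernel_in_fock_space[of w]] assms
    by (simp add: fock_reproducing)
qed

section \<open>Components orthogonal to a unit vector\<close>

lemma fock_inner_add_scale_both:
  assumes "f \<in> fock_space" "g \<in> fock_space" "e \<in> fock_space"
  shows "fock_inner (\<lambda>z. f z + a * e z) (\<lambda>z. g z + c * e z)
    = fock_inner f g + cnj c * fock_inner f e + a * (fock_inner e g + cnj c * fock_inner e e)"
  using assms
  by (simp add: fock_inner_add_scale fock_inner_add_scale_right fock_space_add_scale)

text \<open>With the unit test vector as \<open>e\<close>, this formula expresses the difference
  between a value of the numerical range and the focus \<open>\<psi> b\<close> as an inner product
  of projections.\<close>

lemma fock_inner_sub_projection:
  assumes f: "f \<in> fock_space" and g: "g \<in> fock_space" and e: "e \<in> fock_space" "fock_norm e = 1"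
  shows "fock_inner (\<lambda>z. f z + - fock_inner f e * e z) (\<lambda>z. g z + - fock_inner g e * e z)
    = fock_inner f g - fock_inner f e * fock_inner e g"
  unfolding fock_inner_add_scale_both[OF f g e(1)] fock_inner_self e(2)
  by (simp add: fock_inner_cnj algebra_simps)

lemma fock_norm_sub_projection_unit:
  assumes "f \<in> fock_space" "e \<in> fock_space" "fock_norm e = 1"
  shows "(fock_norm (\<lambda>z. f z + - fock_inner f e * e z))\<^sup>2 = (fock_norm f)\<^sup>2 - (cmod (fock_inner f e))\<^sup>2"
  using fock_norm_sub_projection[of f e] assms by simp

text \<open>Some kernel has a nonzero component orthogonal to \<open>e\<close>. Otherwise all
  kernels are multiples of \<open>e\<close>; the constant kernel at \<open>0\<close> forces
  \<open>e 1 = e 0\<close>, and the kernel at \<open>1\<close> then gives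
  \<open>exp 1 = exp 0\<close>. The vector is needed when \<psi> is a multiple of the kernel at
  \<open>b\<close>.\<close>

lemma fock_space_exists_orthogonal_unit:
  assumes "e \<in> fock_space" "fock_norm e = 1"
  obtains e' where "e' \<in> fock_space" "fock_norm e' = 1" "fock_inner e' e = 0"
proof -
  define P where "P = (\<lambda>w z. fock_kernel w z + - fock_inner (fock_kernel w) e * e z)"
  have P: "P w \<in> fock_space" for w
    unfolding P_def by (intro fock_space_add_scale fock_kernel_in_fock_space assms)
  have orth: "fock_inner (P w) e = 0" for w
    unfolding P_def fock_inner_add_scale[OF fock_kernel_in_fock_space assms(1) assms(1)]
      fock_inner_self assms(2) by simp
  have "\<exists>w. P w \<noteq> (\<lambda>_. 0)"
  proof (rule ccontr)
    assume "\<nexists>w. P w \<noteq> (\<lambda>_. 0)"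
    then have zero: "P w z = 0" for w z by metis
    define c where "c = (\<lambda>w. fock_inner (fock_kernel w) e)"
    have eq: "fock_kernel w z = c w * e z" for w z
      using zero[of w z] by (simp add: P_def c_def)
    have one: "c 0 * e z = 1" for z
      using eq[of 0 z] by (simp add: fock_kernel_def)
    have "c 0 \<noteq> 0" using one[of 0] by auto
    then have const: "e 1 = e 0"
      using one[of 0] one[of 1] by (metis mult_left_cancel)
    have "exp (1::complex) = exp 0"
      using eq[of 1 1] eq[of 1 0] const by (simp add: fock_kernel_def)
    then have "cmod (exp 1) = cmod (exp 0)" by (rule arg_cong)
    then show False unfolding norm_exp_eq_Re by simp
  qed
  then obtain w where w: "P w \<noteq> (\<lambda>_. 0)" by blast
  then have n0: "fock_norm (P w) \<noteq> 0"
    using fock_norm_eq_0D[OF P] by blast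
  show ?thesis
  proof (rule that)
    let ?e = "\<lambda>z. of_real (1 / fock_norm (P w)) * P w z"
    show "?e \<in> fock_space" by (intro fock_space_scale P)
    show "fock_norm ?e = 1" unfolding fock_norm_scale norm_of_real using n0 by simp
    show "fock_inner ?e e = 0" unfolding fock_inner_scale orth by simp
  qed
qed

subsection \<open>The numerical range\<close>

text \<open>On the unit sphere of \<open>\<complex>\<^sup>2\<close> the modulus of \<open>x\<close> can be chosen freely; \<open>z\<close> is attained when
  \<open>t = \<bar>x\<bar>\<^sup>2\<close> satisfies \<open>\<bar>z - \<alpha>t\<bar>\<^sup>2 = \<beta>\<^sup>2 t (1 - t)\<close>, and for \<open>z\<close> in the elliptical disk the
  difference of the two sides changes sign between \<open>0\<close> and \<open>\<bar>z\<bar> / R\<close>.\<close>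

lemma ellipse_point_attained:
  fixes \<alpha> z :: complex and \<beta> R :: real
  assumes \<beta>: "0 \<le> \<beta>" and R: "0 \<le> R" "R\<^sup>2 = (cmod \<alpha>)\<^sup>2 + \<beta>\<^sup>2"
    and z: "cmod z + cmod (z - \<alpha>) \<le> R"
  obtains x y where "(cmod x)\<^sup>2 + (cmod y)\<^sup>2 = 1" "x * (\<alpha> * cnj x + of_real \<beta> * cnj y) = z"
proof -
  define h where "h = (\<lambda>t::real. (cmod (z - \<alpha> * of_real t))\<^sup>2 - \<beta>\<^sup>2 * t * (1 - t))"
  define D where "D = Re (z * cnj \<alpha>)"
  have sq: "(cmod (z - \<alpha> * of_real t))\<^sup>2 = (cmod z)\<^sup>2 - 2 * t * D + (cmod \<alpha>)\<^sup>2 * t\<^sup>2" for t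
    by (simp add: cmod_power2 D_def) (simp add: power2_eq_square algebra_simps)
  obtain t where t: "0 \<le> t" "t \<le> 1" "h t = 0"
  proof (cases "z = 0")
    case True
    then show ?thesis using that[of 0] by (simp add: h_def)
  next
    case False
    define s where "s = cmod z / R"
    have zR: "cmod z \<le> R" using z norm_ge_zero[of "z - \<alpha>"] by linarith
    then have Rpos: "0 < R" using False by (meson less_le_trans zero_less_norm_iff)
    have s: "0 \<le> s" "s \<le> 1" "s * R = cmod z"
      using zR Rpos by (simp_all add: s_def)
    \<comment> \<open>Isolating one focal distance before squaring lets the squares of
      \<open>cmod z\<close> cancel, which leaves an inequality linear in \<open>cmod z\<close> and
      \<open>D\<close>.\<close>
    have "(cmod (z - \<alpha>))\<^sup>2 \<le> (R - cmod z)\<^sup>2"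
      using z by (intro power_mono) auto
    then have "(cmod z)\<^sup>2 - 2 * D + (cmod \<alpha>)\<^sup>2 \<le> (R - cmod z)\<^sup>2"
      using sq[of 1] by simp
    then have "2 * (R * cmod z) \<le> \<beta>\<^sup>2 + 2 * D"
      using R(2) by (simp add: power2_diff algebra_simps)
    from mult_left_mono[OF this s(1)]
    have "2 * (cmod z)\<^sup>2 \<le> s * (\<beta>\<^sup>2 + 2 * D)"
      unfolding s(3)[symmetric] by (simp add: power2_eq_square algebra_simps)
    moreover have "h s = R\<^sup>2 * s\<^sup>2 - s * (\<beta>\<^sup>2 + 2 * D) + (cmod z)\<^sup>2"
      unfolding h_def sq R(2) by (simp add: power2_eq_square algebra_simps)
    moreover have "R\<^sup>2 * s\<^sup>2 = (cmod z)\<^sup>2"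
      unfolding s(3)[symmetric] by (simp add: power_mult_distrib)
    ultimately have "h s \<le> 0" by linarith
    moreover have "0 \<le> h 0" by (simp add: h_def)
    moreover have "continuous_on {0..s} h"
      unfolding h_def by (intro continuous_intros)
    ultimately obtain t where "0 \<le> t" "t \<le> s" "h t = 0"
      using IVT2'[of h s 0 0] s(1) by blast
    then show ?thesis using that[of t] s(2) by linarith
  qed
  have ht: "(cmod (z - \<alpha> * of_real t))\<^sup>2 = \<beta>\<^sup>2 * t * (1 - t)"
    using t(3) by (simp add: h_def)
  define x where "x = complex_of_real (sqrt t)"
  have x: "x * cnj x = of_real t" "(cmod x)\<^sup>2 = t"
    using t(1) by (simp_all add: x_def flip: of_real_mult)
  show ?thesis
  proof (cases "\<beta> = 0 \<or> t = 0")
    \<comment> \<open>The coefficient \<open>x * of_real \<beta>\<close> of \<open>cnj y\<close>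
      vanishes and \<open>z = \<alpha> * t\<close>, so \<open>y\<close> only has to meet the norm
      condition.\<close>
    case True
    have "z = \<alpha> * of_real t"
      using ht True by auto
    moreover have \<beta>x: "x * of_real \<beta> = 0"
      using True by (auto simp: x_def)
    moreover have "x * (\<alpha> * cnj x + of_real \<beta> * v) = \<alpha> * (x * cnj x) + x * of_real \<beta> * v" for v
      by (simp add: algebra_simps)
    ultimately have "x * (\<alpha> * cnj x + of_real \<beta> * cnj (of_real (sqrt (1 - t)))) = z"
      unfolding x(1) by simp
    moreover have "(cmod x)\<^sup>2 + (cmod (of_real (sqrt (1 - t))))\<^sup>2 = 1"
      using x(2) t(2) by simp
    ultimately show ?thesis using that by blast
  next
    case False
    \<comment> \<open>The equation for \<open>z\<close> is solved for \<open>y\<close>; the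
      condition \<open>h t = 0\<close> is what gives \<open>y\<close> the squared modulus
      \<open>1 - t\<close>.\<close>
    define y where "y = cnj ((z - \<alpha> * of_real t) / of_real (\<beta> * sqrt t))"
    have "(cmod y)\<^sup>2 = (cmod (z - \<alpha> * of_real t))\<^sup>2 / (\<beta>\<^sup>2 * t)"
      using t(1) unfolding y_def complex_mod_cnj norm_divide norm_of_real
      by (simp add: power_divide power_mult_distrib)
    then have "(cmod y)\<^sup>2 = 1 - t"
      unfolding ht using False by simp
    moreover have xy: "x * of_real \<beta> * cnj y = z - \<alpha> * of_real t"
      using False t(1) by (simp add: y_def x_def)
    have "x * (\<alpha> * cnj x + of_real \<beta> * cnj y) = \<alpha> * (x * cnj x) + x * of_real \<beta> * cnj y"
      by (simp add: algebra_simps)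
    then have "x * (\<alpha> * cnj x + of_real \<beta> * cnj y) = z"
      unfolding x(1) xy by simp
    ultimately show ?thesis using that[of x y] x(2) by simp
  qed
qed

section \<open>The two inclusions between the numerical range and the elliptical set\<close>

lemma fock_numerical_range_subset:
  fixes b :: complex
  assumes \<psi>: "\<psi> \<in> fock_space" and f: "f \<in> fock_space" "fock_norm f = 1"
  defines "w \<equiv> fock_inner (weighted_comp \<psi> (\<lambda>_. b) f) f"
  shows "cmod w + cmod (w - \<psi> b) \<le> fock_norm \<psi> * fock_norm (fock_kernel b)"
proof -
  let ?K = "fock_kernel b"
  let ?P = "\<lambda>g z. g z + - fock_inner g f * f z"
  note K = fock_kernel_in_fock_space[of b]
  have w: "w = fock_inner f ?K * fock_inner \<psi> f"
    unfolding w_def weighted_comp_def fock_reproducing[OF f(1)]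
    using fock_inner_scale[of "f b" \<psi> f] by (simp add: mult.commute)
  have "w - \<psi> b = - fock_inner (?P \<psi>) (?P ?K)"
    unfolding fock_inner_sub_projection[OF \<psi> K f] w fock_reproducing[OF \<psi>] by simp
  moreover have "?P \<psi> \<in> fock_space" "?P ?K \<in> fock_space"
    by (intro fock_space_add_scale \<psi> K f)+
  ultimately have "cmod (w - \<psi> b) \<le> fock_norm (?P \<psi>) * fock_norm (?P ?K)"
    using fock_Cauchy_Schwarz[of "?P \<psi>" "?P ?K"] by (simp only: norm_minus_cancel)
  moreover have "cmod w = cmod (fock_inner \<psi> f) * cmod (fock_inner ?K f)"
    unfolding w norm_mult fock_inner_cnj[of ?K f, symmetric] complex_mod_cnj by simp
  ultimately have "cmod w + cmod (w - \<psi> b)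
      \<le> cmod (fock_inner \<psi> f) * cmod (fock_inner ?K f) + fock_norm (?P \<psi>) * fock_norm (?P ?K)"
    by simp
  also have "\<dots> \<le> sqrt ((cmod (fock_inner \<psi> f))\<^sup>2 + (fock_norm (?P \<psi>))\<^sup>2)
      * sqrt ((cmod (fock_inner ?K f))\<^sup>2 + (fock_norm (?P ?K))\<^sup>2)"
  proof -
    have "a * c + p * q \<le> sqrt (a\<^sup>2 + p\<^sup>2) * sqrt (c\<^sup>2 + q\<^sup>2)" for a c p q :: real
    proof -
      have "(a * c + p * q)\<^sup>2 \<le> (a\<^sup>2 + p\<^sup>2) * (c\<^sup>2 + q\<^sup>2)"
        using zero_le_power2[of "a * q - p * c"] by (simp add: power2_eq_square algebra_simps)
      then show ?thesis
        by (metis real_le_rsqrt real_sqrt_mult)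
    qed
    then show ?thesis .
  qed
  \<comment> \<open>By Pythagoras the components along \<open>f\<close> and orthogonal to
    \<open>f\<close> recombine to the full norms.\<close>
  also have "\<dots> = fock_norm \<psi> * fock_norm ?K"
    unfolding fock_norm_sub_projection_unit[OF \<psi> f] fock_norm_sub_projection_unit[OF K f] by simp
  finally show ?thesis .
qed

text \<open>Let \<open>e\<close> be the normalised kernel and \<open>e'\<close> the normalised rest
  of \<psi>. On their span the operator sends \<open>e\<close> to
  \<open>k * (\<alpha> * e + \<beta> * e')\<close> and \<open>e'\<close> to \<open>0\<close>, so the
  claim reduces to the numerical range of a two by two matrix.\<close>

lemma fock_numerical_range_supset:
  assumes \<psi>: "\<psi> \<in> fock_space"
    and w: "cmod w + cmod (w - \<psi> b) \<le> fock_norm \<psi> * fock_norm (fock_kernel b)"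
  shows "w \<in> numerical_range (weighted_comp \<psi> (\<lambda>_. b))"
proof -
  define k where "k = fock_norm (fock_kernel b)"
  have k: "0 < k" by (simp add: k_def fock_norm_kernel)
  note K = fock_kernel_in_fock_space[of b]
  define e where "e = (\<lambda>z. of_real (1 / k) * fock_kernel b z)"
  have "e \<in> fock_space"
    unfolding e_def by (rule fock_space_scale[OF K])
  moreover have "fock_norm e = 1"
    unfolding e_def fock_norm_scale k_def[symmetric] norm_of_real using k by simp
  ultimately have e: "e \<in> fock_space" "fock_norm e = 1" .
  have inner_e: "fock_inner f e = f b / of_real k" if "f \<in> fock_space" for f
  proof -
    have "fock_inner f e = cnj (of_real (1 / k)) * fock_inner f (fock_kernel b)"
      unfolding e_def by (rule fock_inner_scale_right)
    also have "fock_inner f (fock_kernel b) = f b"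
      by (rule fock_reproducing) fact
    finally show ?thesis by simp
  qed
  define \<alpha> where "\<alpha> = fock_inner \<psi> e"
  define \<psi>' where "\<psi>' = (\<lambda>z. \<psi> z + - \<alpha> * e z)"
  have \<psi>': "\<psi>' \<in> fock_space"
    unfolding \<psi>'_def by (intro fock_space_add_scale \<psi> e)
  have orth: "fock_inner \<psi>' e = 0"
    unfolding \<psi>'_def fock_inner_add_scale[OF \<psi> e(1) e(1)] fock_inner_self e by (simp add: \<alpha>_def)
  define \<beta> where "\<beta> = fock_norm \<psi>'"
  have \<beta>: "0 \<le> \<beta>" "(fock_norm \<psi>)\<^sup>2 = (cmod \<alpha>)\<^sup>2 + \<beta>\<^sup>2"
    using fock_norm_sub_projection_unit[OF \<psi> e] by (simp_all add: \<beta>_def \<psi>'_def \<alpha>_def)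
  \<comment> \<open>If the rest of \<psi> is zero it cannot be normalised, and an arbitrary
    orthogonal unit vector takes its place; the expansion of \<psi> is the same in both
    cases.\<close>
  obtain e' where e': "e' \<in> fock_space" "fock_norm e' = 1" "fock_inner e' e = 0"
    and \<psi>'_eq: "\<And>z. \<psi>' z = of_real \<beta> * e' z"
  proof (cases "\<beta> = 0")
    case True
    then show ?thesis
      using fock_space_exists_orthogonal_unit[OF e] fock_norm_eq_0D[OF \<psi>'] that
      unfolding \<beta>_def by (metis mult_zero_left of_real_0)
  next
    case False
    show ?thesis
    proof (rule that)
      let ?e = "\<lambda>z. of_real (1 / \<beta>) * \<psi>' z"
      show "?e \<in> fock_space" by (intro fock_space_scale \<psi>')
      show "fock_norm ?e = 1"
        unfolding fock_norm_scale norm_of_real using False by (simp add: \<beta>_def)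
      show "fock_inner ?e e = 0" unfolding fock_inner_scale orth by simp
      show "\<psi>' z = of_real \<beta> * ?e z" for z using False by simp
    qed
  qed
  have orth': "fock_inner e e' = 0"
    using fock_inner_cnj[of e' e] e' by simp
  have \<psi>_eq: "\<psi> = (\<lambda>z. \<alpha> * e z + of_real \<beta> * e' z)"
    using \<psi>'_eq by (auto simp: \<psi>'_def fun_eq_iff algebra_simps)
  \<comment> \<open>Scaling by \<open>1 / k\<close> moves the focus \<open>\<psi> b\<close> to
    \<alpha> and turns the bound into \<open>fock_norm \<psi>\<close>.\<close>
  have "cmod (w / of_real k) + cmod (w / of_real k - \<alpha>) \<le> fock_norm \<psi>"
  proof -
    have "w / of_real k - \<alpha> = (w - \<psi> b) / of_real k"
      unfolding \<alpha>_def inner_e[OF \<psi>] by (simp add: diff_divide_distrib)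
    then show ?thesis
      using w k by (simp add: norm_divide field_simps flip: k_def)
  qed
  from ellipse_point_attained[OF \<beta>(1) fock_norm_nonneg \<beta>(2) this]
  obtain x y where xy: "(cmod x)\<^sup>2 + (cmod y)\<^sup>2 = 1"
    "x * (\<alpha> * cnj x + of_real \<beta> * cnj y) = w / of_real k" by blast
  define f where "f = (\<lambda>z. x * e z + y * e' z)"
  note F = fock_space_scale[OF e(1)] fock_space_scale[OF e'(1)] e e'
  have f: "f \<in> fock_space"
    unfolding f_def by (intro fock_space_add_scale F)
  have "fock_inner f e = x"
    unfolding f_def using F by (simp add: fock_inner_add_scale fock_inner_scale fock_inner_self)
  then have fb: "f b = of_real k * x"
    using inner_e[OF f] k by (simp add: field_simps)
  have "(fock_norm f)\<^sup>2 = 1"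
    unfolding f_def fock_norm_add_scale[OF F(1) e'(1)] fock_norm_scale fock_inner_scale orth'
    using xy(1) e e' by simp
  then have "fock_norm f = 1"
    using fock_norm_nonneg[of f] unfolding power2_eq_1_iff by linarith
  have "fock_inner \<psi> f = \<alpha> * cnj x + of_real \<beta> * cnj y"
    unfolding f_def \<psi>_eq using F orth'
    by (simp add: fock_inner_add_scale fock_inner_add_scale_right fock_inner_scale
        fock_inner_scale_right fock_inner_self fock_space_add_scale algebra_simps)
  then have "fock_inner (weighted_comp \<psi> (\<lambda>_. b) f) f = f b * (\<alpha> * cnj x + of_real \<beta> * cnj y)"
    unfolding weighted_comp_def using fock_inner_scale[of "f b" \<psi> f] by (simp add: mult.commute)
  also have "\<dots> = w"
    using xy(2) k unfolding fb by (simp add: field_simps)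
  finally show ?thesis
    using f \<open>fock_norm f = 1\<close> unfolding numerical_range_def by blast
qed

text \<open>This one description degenerates to a segment when the bound equals the distance of the
  foci, and to a disk when the foci coincide.\<close>

lemma fock_numerical_range:
  assumes "\<psi> \<in> fock_space"
  shows "numerical_range (weighted_comp \<psi> (\<lambda>_. b))
    = {w. dist w 0 + dist w (\<psi> b) \<le> fock_norm \<psi> * fock_norm (fock_kernel b)}"
proof (intro equalityI subsetI)
  fix w assume "w \<in> numerical_range (weighted_comp \<psi> (\<lambda>_. b))"
  then show "w \<in> {w. dist w 0 + dist w (\<psi> b) \<le> fock_norm \<psi> * fock_norm (fock_kernel b)}"
    using fock_numerical_range_subset[OF assms] by (auto simp: numerical_range_def dist_norm)
next
  fix w assume "w \<in> {w. dist w 0 + dist w (\<psi> b) \<le> fock_norm \<psi> * fock_norm (fock_kernel b)}"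
  then show "w \<in> numerical_range (weighted_comp \<psi> (\<lambda>_. b))"
    using fock_numerical_range_supset[OF assms] by (simp add: dist_norm)
qed

section \<open>Boundedness and the three cases\<close>

lemma fock_bounded_weighted_comp_const:
  assumes "\<psi> holomorphic_on UNIV"
  shows "fock_bounded (weighted_comp \<psi> (\<lambda>_. b)) \<longleftrightarrow> \<psi> \<in> fock_space"
proof
  assume "fock_bounded (weighted_comp \<psi> (\<lambda>_. b))"
  \<comment> \<open>The kernel at \<open>0\<close> is the constant function \<open>1\<close>, and
    its image is \<psi>.\<close>
  then have "weighted_comp \<psi> (\<lambda>_. b) (fock_kernel 0) \<in> fock_space"
    using fock_kernel_in_fock_space by (auto simp: fock_bounded_def)
  then show "\<psi> \<in> fock_space" by (simp add: weighted_comp_def fock_kernel_def)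
next
  assume \<psi>: "\<psi> \<in> fock_space"
  have eq: "weighted_comp \<psi> (\<lambda>_. b) f = (\<lambda>z. f b * \<psi> z)" for f
    by (simp add: weighted_comp_def mult.commute)
  have "fock_norm (weighted_comp \<psi> (\<lambda>_. b) f) \<le> fock_norm (fock_kernel b) * fock_norm \<psi> * fock_norm f"
    if f: "f \<in> fock_space" for f
    using mult_right_mono[OF fock_Cauchy_Schwarz[OF f fock_kernel_in_fock_space[of b]], of "fock_norm \<psi>"]
    unfolding eq fock_norm_scale fock_reproducing[OF f] by (simp add: mult_ac)
  then show "fock_bounded (weighted_comp \<psi> (\<lambda>_. b))"
    unfolding fock_bounded_def using fock_space_scale[OF \<psi>] by (auto simp: eq)
qed

theorem mainTheorem5:
  fixes b :: complex and \<phi> \<psi> :: "complex \<Rightarrow> complex"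
  assumes "\<phi> = (\<lambda>_. b)"
    and "\<psi> holomorphic_on UNIV"
    and "\<psi> \<noteq> (\<lambda>_. 0)"
  shows
    "(fock_bounded (weighted_comp \<psi> \<phi>) \<longleftrightarrow> \<psi> \<in> fock_space) \<and>
     (fock_bounded (weighted_comp \<psi> \<phi>) \<longrightarrow>
       (\<forall>c. c \<noteq> 0 \<and> fock_kernel b = (\<lambda>z. c / complex_of_real ((fock_norm \<psi>)\<^sup>2) * \<psi> z) \<longrightarrow>
          numerical_range (weighted_comp \<psi> \<phi>) = closed_segment 0 (cnj c)) \<and>
       (fock_inner (fock_kernel b) \<psi> = 0 \<longrightarrow>
          numerical_range (weighted_comp \<psi> \<phi>)
            = cball 0 (fock_norm \<psi> / 2 * exp ((cmod b)\<^sup>2 / 2))) \<and>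
       ((\<nexists>c. c \<noteq> 0 \<and> fock_kernel b = (\<lambda>z. c / complex_of_real ((fock_norm \<psi>)\<^sup>2) * \<psi> z)) \<and>
        fock_inner (fock_kernel b) \<psi> \<noteq> 0 \<longrightarrow>
          closed_ellipse_with_foci 0 (\<psi> b) (numerical_range (weighted_comp \<psi> \<phi>))) \<and>
       0 \<in> numerical_range (weighted_comp \<psi> \<phi>))"
  unfolding assms(1) fock_bounded_weighted_comp_const[OF assms(2)]
proof (intro conjI impI allI refl)
  let ?K = "fock_kernel b" and ?W = "numerical_range (weighted_comp \<psi> (\<lambda>_. b))"
  assume \<psi>: "\<psi> \<in> fock_space"
  note K = fock_kernel_in_fock_space[of b]
  have n: "fock_norm \<psi> \<noteq> 0"
    using fock_norm_eq_0D[OF \<psi>] assms(3) by blast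
  note W = fock_numerical_range[OF \<psi>, of b]
  have \<psi>b: "cmod (\<psi> b) = cmod (fock_inner ?K \<psi>)"
    using fock_reproducing[OF \<psi>, of b] fock_inner_cnj[of ?K \<psi>] complex_mod_cnj by metis
  \<comment> \<open>The distance of the foci never exceeds the bound. This puts \<open>0\<close>
    into the set and leaves only strictness to be shown for a genuine ellipse.\<close>
  have CS: "cmod (\<psi> b) \<le> fock_norm \<psi> * fock_norm ?K"
    using fock_Cauchy_Schwarz[OF \<psi> K] by (simp add: fock_reproducing[OF \<psi>])
  then show "0 \<in> ?W"
    unfolding W by (simp add: dist_norm)
  show "?W = closed_segment 0 (cnj c)"
    if c: "c \<noteq> 0 \<and> ?K = (\<lambda>z. c / complex_of_real ((fock_norm \<psi>)\<^sup>2) * \<psi> z)" for c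
  proof -
    let ?a = "c / complex_of_real ((fock_norm \<psi>)\<^sup>2)"
    have Keq: "?K = (\<lambda>z. ?a * \<psi> z)" using c by blast
    have "fock_inner \<psi> ?K = cnj ?a * fock_inner \<psi> \<psi>"
      unfolding Keq by (rule fock_inner_scale_right)
    then have p: "\<psi> b = cnj c"
      using n by (simp add: fock_inner_self fock_reproducing[OF \<psi>])
    have "fock_norm ?K = cmod ?a * fock_norm \<psi>"
      unfolding Keq by (rule fock_norm_scale)
    then have r: "fock_norm \<psi> * fock_norm ?K = cmod c"
      unfolding norm_divide norm_of_real using n by (simp add: power2_eq_square)
    \<comment> \<open>Here the bound equals the distance of the foci, so the triangle inequality
      forces equality, which means that \<open>w\<close> lies between them.\<close>
    have "dist w 0 + dist w (cnj c) \<le> cmod c \<longleftrightarrow> w \<in> closed_segment 0 (cnj c)" for w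
      unfolding between_mem_segment[symmetric] between
      using dist_triangle[of 0 "cnj c" w] by (auto simp: dist_commute)
    then show ?thesis
      unfolding W p r by blast
  qed
  \<comment> \<open>Both foci are at \<open>0\<close>, so the condition says that
    \<open>2 * cmod w\<close> is at most the bound.\<close>
  show "?W = cball 0 (fock_norm \<psi> / 2 * exp ((cmod b)\<^sup>2 / 2))" if "fock_inner ?K \<psi> = 0"
    using \<psi>b that unfolding W by (auto simp: fock_norm_kernel)
  show "closed_ellipse_with_foci 0 (\<psi> b) ?W"
    if "(\<nexists>c. c \<noteq> 0 \<and> ?K = (\<lambda>z. c / complex_of_real ((fock_norm \<psi>)\<^sup>2) * \<psi> z)) \<and> fock_inner ?K \<psi> \<noteq> 0"
  proof -
    let ?u = "fock_inner ?K \<psi>"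
    let ?f = "\<lambda>z. ?K z + - (?u / of_real ((fock_norm \<psi>)\<^sup>2)) * \<psi> z"
    \<comment> \<open>Equality in Cauchy-Schwarz would make the kernel equal to its projection onto
      \<psi>. This is the excluded form with \<open>c = ?u\<close>, which is nonzero by
      assumption.\<close>
    have "cmod (\<psi> b) \<noteq> fock_norm \<psi> * fock_norm ?K"
    proof
      assume "cmod (\<psi> b) = fock_norm \<psi> * fock_norm ?K"
      then have "(fock_norm ?f)\<^sup>2 = 0"
        unfolding fock_norm_sub_projection[OF K \<psi> n] \<psi>b using n by (simp add: power_mult_distrib)
      then have "?f = (\<lambda>_. 0)"
        by (intro fock_norm_eq_0D fock_space_add_scale K \<psi>) simp
      then have "?K = (\<lambda>z. ?u / complex_of_real ((fock_norm \<psi>)\<^sup>2) * \<psi> z)"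
        by (simp add: fun_eq_iff)
      with that show False by blast
    qed
    with CS show ?thesis
      unfolding W closed_ellipse_with_foci_def
      by (intro exI[of _ "fock_norm \<psi> * fock_norm ?K"]) simp
  qed
qed

end
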